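(* Let $\mathbf{G}(s)=\mathbf{C}(s\mathbf{I}-\mathbf{A})^{-1}\mathbf{B}$ be a stabilizable and detectable linear system and $\widehat{\mathbf{G}}(s)=\widehat{\mathbf{C}}(s\mathbf{I}-\widehat{\mathbf{A}})^{-1}\widehat{\mathbf{B}}$ a stabilizable and detectable reduced model, with closed-loop transfer functions $\mathbf{G}_{\mathbf{F}}=[\mathbf{M},\mathbf{N}]$ and $\widehat{\mathbf{G}}_{\mathbf{F}}=[\widehat{\mathbf{M}},\widehat{\mathbf{N}}]$ (defined in the context), having the pole-residue representations $$\mathbf{G}_{\mathbf{F}}(s)=[\mathbf{I},0]+\sum_{i=1}^n\frac{\mathbf{c}_i[\mathbf{f}_i^T,\mathbf{b}_i^T]}{s-\lambda_i},\qquad \widehat{\mathbf{G}}_{\mathbf{F}}(s)=[\mathbf{I},0]+\sum_{j=1}^r\frac{\widehat{\mathbf{c}}_j[\widehat{\mathbf{f}}_j^T,\widehat{\mathbf{b}}_j^T]}{s-\widehat{\lambda}_j}$$ given in the context. Assume that $\sigma(\mathbf{A})\cap\sigma(-\mathbf{A}_{\mathbf{F}})=\emptyset$. (1) For $i=1,\dots,n$: if $\widehat{\mathbf{G}}(-\lambda_i)\mathbf{b}_i=\mathbf{G}(-\lambda_i)\mathbf{b}_i$, then $$\widehat{\mathbf{G}}_{\mathbf{F}}(-\lambda_i)\begin{bmatrix}\mathbf{f}_i\\ \mathbf{b}_i\end{bmatrix}=\mathbf{G}_{\mathbf{F}}(-\lambda_i)\begin{bmatrix}\mathbf{f}_i\\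 \mathbf{b}_i\end{bmatrix}=0.$$ (2) Moreover, for $j=1,\dots,r$: if $\widehat{\mathbf{G}}(-\widehat{\lambda}_j)\widehat{\mathbf{b}}_j=\mathbf{G}(-\widehat{\lambda}_j)\widehat{\mathbf{b}}_j$, then $$\widehat{\mathbf{G}}_{\mathbf{F}}(-\widehat{\lambda}_j)\begin{bmatrix}\widehat{\mathbf{f}}_j\\ \widehat{\mathbf{b}}_j\end{bmatrix}=\mathbf{G}_{\mathbf{F}}(-\widehat{\lambda}_j)\begin{bmatrix}\widehat{\mathbf{f}}_j\\ \widehat{\mathbf{b}}_j\end{bmatrix}=0.$$
   Context: $\mathbf{A}\in\mathbb{R}^{n\times n}$, $\mathbf{B}\in\mathbb{R}^{n\times m}$, $\mathbf{C}\in\mathbb{R}^{p\times n}$, $\widehat{\mathbf{A}}\in\mathbb{R}^{r\times r}$, $\widehat{\mathbf{B}}\in\mathbb{R}^{r\times m}$, $\widehat{\mathbf{C}}\in\mathbb{R}^{p\times r}$; $\sigma(\cdot)$ denotes the spectrum. "Stabilizable and detectable" means $(\mathbf{A},\mathbf{B})$ is stabilizable and $(\mathbf{A},\mathbf{C})$ is detectable (and likewise for the hatted system). Let $\mathbf{P}=\mathbf{P}^T\succeq 0$ be the solution of $\mathbf{A}\mathbf{P}+\mathbf{P}\mathbf{A}^T-\mathbf{P}\mathbf{C}^T\mathbf{C}\mathbf{P}+\mathbf{B}\mathbf{B}^T=0$, $\mathbf{F}=\mathbf{P}\mathbf{C}^T$, and $\mathbf{A}_{\mathbf{F}}=\mathbf{A}-\mathbf{F}\mathbf{C}$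 (asymptotically stable). Set $\mathbf{M}(s)=\mathbf{I}-\mathbf{C}(s\mathbf{I}-\mathbf{A}_{\mathbf{F}})^{-1}\mathbf{F}$, $\mathbf{N}(s)=\mathbf{C}(s\mathbf{I}-\mathbf{A}_{\mathbf{F}})^{-1}\mathbf{B}$, so $\mathbf{G}=\mathbf{M}^{-1}\mathbf{N}$, and $\mathbf{G}_{\mathbf{F}}=[\mathbf{M},\mathbf{N}]$. The quantities $\widehat{\mathbf{P}}$, $\widehat{\mathbf{F}}=\widehat{\mathbf{P}}\widehat{\mathbf{C}}^T$, $\widehat{\mathbf{A}}_{\widehat{\mathbf{F}}}=\widehat{\mathbf{A}}-\widehat{\mathbf{F}}\widehat{\mathbf{C}}$, $\widehat{\mathbf{M}}$, $\widehat{\mathbf{N}}$, $\widehat{\mathbf{G}}_{\mathbf{F}}=[\widehat{\mathbf{M}},\widehat{\mathbf{N}}]$ are defined in the same way from $(\widehat{\mathbf{A}},\widehat{\mathbf{B}},\widehat{\mathbf{C}})$. Pole-residue data: the eigenvalues $\lambda_1,\dots,\lambda_n$ of $\mathbf{A}_{\mathbf{F}}$ are assumed semi-simple. Let $\mathbf{W}=[\mathbf{w}_1,\dots,\mathbf{w}_n]\in\mathbb{C}^{n\times n}$ be an invertible matrix of left eigenvectors, $\mathbf{w}_i^T\mathbf{A}_{\mathbf{F}}=\lambda_i\mathbf{w}_i^T$ (transpose, not conjugate transpose), and $\mathbf{V}=[\mathbf{v}_1,\dots,\mathbf{v}_n]=\mathbf{W}^{-T}$. Then $\mathbf{b}_i=\mathbf{B}^T\mathbf{w}_i$,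 $\mathbf{f}_i=-\mathbf{F}^T\mathbf{w}_i=-\mathbf{C}\mathbf{P}\mathbf{w}_i$, $\mathbf{c}_i=\mathbf{C}\mathbf{v}_i$. The data $\widehat{\lambda}_j$, $\widehat{\mathbf{w}}_j$, $\widehat{\mathbf{v}}_j$, $\widehat{\mathbf{b}}_j=\widehat{\mathbf{B}}^T\widehat{\mathbf{w}}_j$, $\widehat{\mathbf{f}}_j=-\widehat{\mathbf{F}}^T\widehat{\mathbf{w}}_j=-\widehat{\mathbf{C}}\widehat{\mathbf{P}}\widehat{\mathbf{w}}_j$, $\widehat{\mathbf{c}}_j=\widehat{\mathbf{C}}\widehat{\mathbf{v}}_j$, $j=1,\dots,r$, are defined in the same way from $\widehat{\mathbf{A}}_{\widehat{\mathbf{F}}}$, whose eigenvalues are likewise assumed semi-simple. *)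

theory Defs
  imports "HOL-Analysis.Analysis"
begin

abbreviation cmat :: "real^'a^'b \<Rightarrow> complex^'a^'b" where
  "cmat \<equiv> map_matrix complex_of_real"

definition mat_spectrum :: "complex^'n^'n \<Rightarrow> complex set" where
  "mat_spectrum A = {z. \<exists>v. v \<noteq> 0 \<and> A *v v = z *s v}"

definition asymptotically_stable :: "real^'n^'n \<Rightarrow> bool" where
  "asymptotically_stable A \<longleftrightarrow> (\<forall>z \<in> mat_spectrum (cmat A). Re z < 0)"

definition stabilizable :: "real^'n^'n \<Rightarrow> real^'m^'n \<Rightarrow> bool" where
  "stabilizable A B \<longleftrightarrow> (\<exists>K :: real^'n^'m. asymptotically_stable (A - B ** K))"

definition detectable :: "real^'n^'n \<Rightarrow> real^'n^'p \<Rightarrow> bool" where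
  "detectable A C \<longleftrightarrow> (\<exists>L :: real^'p^'n. asymptotically_stable (A - L ** C))"

definition riccati_solution ::
  "real^'n^'n \<Rightarrow> real^'m^'n \<Rightarrow> real^'n^'p \<Rightarrow> real^'n^'n \<Rightarrow> bool" where
  "riccati_solution A B C P \<longleftrightarrow>
     transpose P = P \<and> (\<forall>x. 0 \<le> x \<bullet> (P *v x)) \<and>
     A ** P + P ** transpose A - P ** transpose C ** C ** P + B ** transpose B = 0"

definition filter_gain :: "real^'n^'p \<Rightarrow> real^'n^'n \<Rightarrow> real^'p^'n" where
  "filter_gain C P = P ** transpose C"

definition closed_loop :: "real^'n^'n \<Rightarrow> real^'n^'p \<Rightarrow> real^'n^'n \<Rightarrow> real^'n^'n" where
  "closed_loop A C P = A - filter_gain C P ** C"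

text \<open>The value of a resolvent is meaningful only for points outside the spectrum:
  \<^const>\<open>matrix_inv\<close> returns an unspecified matrix at a singular argument.
  Note that \<^term>\<open>mat s\<close> is the scalar matrix with diagonal entries \<^term>\<open>s\<close>.\<close>

definition resolvent :: "real^'n^'n \<Rightarrow> complex \<Rightarrow> complex^'n^'n" where
  "resolvent A s = matrix_inv (mat s - cmat A)"

definition transfer ::
  "real^'n^'n \<Rightarrow> real^'m^'n \<Rightarrow> real^'n^'p \<Rightarrow> complex \<Rightarrow> complex^'m^'p" where
  "transfer A B C s = cmat C ** resolvent A s ** cmat B"

definition hcat :: "'a^'m^'p \<Rightarrow> 'a^'k^'p \<Rightarrow> 'a^('m + 'k)^'p" where
  "hcat X Y = (\<chi> i j. case j of Inl a \<Rightarrow> X $ i $ a | Inr b \<Rightarrow> Y $ i $ b)"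

definition vcat :: "'a^'m \<Rightarrow> 'a^'k \<Rightarrow> 'a^('m + 'k)" where
  "vcat x y = (\<chi> j. case j of Inl a \<Rightarrow> x $ a | Inr b \<Rightarrow> y $ b)"

definition factor_M ::
  "real^'n^'n \<Rightarrow> real^'n^'p \<Rightarrow> real^'n^'n \<Rightarrow> complex \<Rightarrow> complex^'p^'p" where
  "factor_M A C P s =
     mat 1 - cmat C ** resolvent (closed_loop A C P) s ** cmat (filter_gain C P)"

definition factor_N ::
  "real^'n^'n \<Rightarrow> real^'m^'n \<Rightarrow> real^'n^'p \<Rightarrow> real^'n^'n \<Rightarrow> complex \<Rightarrow> complex^'m^'p" where
  "factor_N A B C P s = cmat C ** resolvent (closed_loop A C P) s ** cmat B"

definition closed_loop_transfer ::
  "real^'n^'n \<Rightarrow> real^'m^'n \<Rightarrow> real^'n^'p \<Rightarrow> real^'n^'n \<Rightarrow> complex \<Rightarrow> complex^('p + 'm)^'p" where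
  "closed_loop_transfer A B C P s = hcat (factor_M A C P s) (factor_N A B C P s)"

text \<open>The columns \<open>w\<^sub>i\<close> of \<open>W\<close> form a basis of left eigenvectors,
  \<open>w\<^sub>i\<^sup>T A = \<lambda>\<^sub>i w\<^sub>i\<^sup>T\<close>. Such a basis exists iff all eigenvalues of \<open>A\<close> are semi-simple;
  \<open>\<lambda>\<close> then lists the eigenvalues with their multiplicities.\<close>

definition left_eigenbasis ::
  "real^'n^'n \<Rightarrow> ('n \<Rightarrow> complex) \<Rightarrow> complex^'n^'n \<Rightarrow> bool" where
  "left_eigenbasis A lam W \<longleftrightarrow>
     invertible W \<and> (\<forall>i. column i W v* cmat A = lam i *s column i W)"

definition residue_b :: "real^'m^'n \<Rightarrow> complex^'n^'n \<Rightarrow> 'n \<Rightarrow> complex^'m" where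
  "residue_b B W i = transpose (cmat B) *v column i W"

definition residue_f :: "real^'n^'p \<Rightarrow> real^'n^'n \<Rightarrow> complex^'n^'n \<Rightarrow> 'n \<Rightarrow> complex^'p" where
  "residue_f C P W i = - (transpose (cmat (filter_gain C P)) *v column i W)"

definition residue_c :: "real^'n^'p \<Rightarrow> complex^'n^'n \<Rightarrow> 'n \<Rightarrow> complex^'p" where
  "residue_c C W i = cmat C *v column i (matrix_inv (transpose W))"

lemma not_in_mat_spectrum_iff: "s \<notin> mat_spectrum A \<longleftrightarrow> invertible (mat s - A)"
proof -
  have "(mat s - A) *v v = s *s v - A *v v" for v
    by (simp add: matrix_vector_mult_diff_rdistrib) 
       (simp add: vec_eq_iff matrix_vector_mult_def mat_def if_distrib if_distribR cong: if_cong)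
  hence "s \<notin> mat_spectrum A \<longleftrightarrow> (\<forall>v. (mat s - A) *v v = 0 \<longrightarrow> v = 0)"
    by (auto simp: mat_spectrum_def)
  thus ?thesis
    by (simp add: invertible_left_inverse matrix_left_invertible_ker)
qed

lemma pole_residue_form:
  fixes A :: "real^'n^'n" and B :: "real^'m^'n" and C :: "real^'n^'p"
  assumes eig: "left_eigenbasis (closed_loop A C P) lam W"
    and s: "s \<notin> mat_spectrum (cmat (closed_loop A C P))"
  shows "closed_loop_transfer A B C P s = hcat (mat 1) 0 +
    (\<Sum>i\<in>UNIV. \<chi> k l. residue_c C W i $ k *
       vcat (residue_f C P W i) (residue_b B W i) $ l / (s - lam i))"
proof -
  define AF where "AF = closed_loop A C P"
  define S where "S = mat s - cmat AF"
  define R where "R = resolvent AF s"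
  have inv: "invertible S"
    using s by (simp add: not_in_mat_spectrum_iff S_def AF_def)
  have SR: "S ** R = mat 1" "R ** S = mat 1"
    unfolding R_def resolvent_def S_def[symmetric]
    using inv matrix_inv_def[of S] someI_ex[OF inv[unfolded invertible_def]] by auto
  have invW: "invertible W" and w: "column i W v* cmat AF = lam i *s column i W" for i
    using eig by (auto simp: left_eigenbasis_def AF_def)
  obtain W' where W': "W ** W' = mat 1" "W' ** W = mat 1"
    using invW by (auto simp: invertible_def)
  define V where "V = matrix_inv (transpose W)"
  have "invertible (transpose W)"
    unfolding invertible_def by (metis W' matrix_transpose_mul transpose_mat)
  hence V: "V ** transpose W = mat 1"
    unfolding V_def invertible_def matrix_inv_def
    by (metis (mono_tags, lifting) someI_ex)
  have wS: "column i W v* S = (s - lam i) *s column i W" for i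
  proof -
    have "column i W v* mat s = s *s column i W"
      by (simp add: vec_eq_iff vector_matrix_mult_def mat_def if_distrib if_distribR mult.commute cong: if_cong)
    moreover have "column i W v* S = column i W v* mat s - column i W v* cmat AF"
      by (simp add: S_def vec_eq_iff vector_matrix_mult_def algebra_simps sum_subtractf)
    ultimately show ?thesis
      by (simp add: w vec_eq_iff algebra_simps)
  qed
  have wR: "column i W = (s - lam i) *s (column i W v* R)" for i
  proof -
    have "column i W = column i W v* (S ** R)" by (simp add: SR)
    also have "\<dots> = ((s - lam i) *s column i W) v* R"
      by (simp add: vector_matrix_mul_assoc[symmetric] wS)
    also have "\<dots> = (s - lam i) *s (column i W v* R)"
    proof -
      have "(c *s x) v* R = c *s (x v* R)" for c and x :: "complex^'n"
        by (simp add: vec_eq_iff vector_matrix_mult_def sum_distrib_left mult_ac)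
      thus ?thesis .
    qed
    finally show ?thesis .
  qed
  have nz: "s - lam i \<noteq> 0" for i
  proof
    assume "s - lam i = 0"
    hence "column i W = 0" using wR[of i] by simp
    hence "W *v axis i 1 = 0" by (simp add: matrix_vector_mul_component vec_eq_iff column_def
        matrix_vector_mult_def axis_def if_distrib cong: if_cong)
    hence "W' *v (W *v axis i 1) = 0" by simp
    hence "axis i (1::complex) = (0 :: complex^'n)" by (simp add: matrix_vector_mul_assoc W')
    thus False by (simp add: axis_eq_0_iff)
  qed
  have CRX: "(cmat C ** R ** cmat X) $ k $ l =
      (\<Sum>i\<in>UNIV. residue_c C W i $ k * (transpose (cmat X) *v column i W) $ l / (s - lam i))"
    for X :: "real^'q^'n" and k l
  proof -
    have col: "(transpose W ** R) $ i $ j = column i W $ j / (s - lam i)" for i j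
    proof -
      have "(transpose W ** R) $ i $ j = (column i W v* R) $ j"
        by (simp add: matrix_matrix_mult_def vector_matrix_mult_def transpose_def column_def mult.commute)
      thus ?thesis using nz[of i] arg_cong[OF wR[of i], of "\<lambda>x. x $ j"] by (simp add: field_simps)
    qed
    have "(transpose W ** R ** cmat X) $ i $ l =
        (transpose (cmat X) *v column i W) $ l / (s - lam i)" for i
      by (simp add: matrix_matrix_mult_def[of "transpose W ** R"] col)
         (simp add: vector_matrix_mult_def sum_divide_distrib mult.commute)
    moreover have "(cmat C ** V) $ k $ i = residue_c C W i $ k" for i
      by (simp add: residue_c_def V_def matrix_matrix_mult_def matrix_vector_mult_def column_def)
    moreover have "cmat C ** R ** cmat X = (cmat C ** V) ** (transpose W ** R ** cmat X)"
    proof -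
      have "(cmat C ** V) ** (transpose W ** R ** cmat X) = cmat C ** (V ** transpose W) ** R ** cmat X"
        by (simp add: matrix_mul_assoc)
      thus ?thesis by (simp add: V)
    qed
    ultimately show ?thesis
      by (simp add: matrix_matrix_mult_def[of "cmat C ** V"])
  qed
  show ?thesis
    unfolding closed_loop_transfer_def factor_M_def factor_N_def R_def[symmetric] AF_def[symmetric]
    by (simp add: vec_eq_iff hcat_def vcat_def CRX residue_b_def residue_f_def sum_negf
          split: sum.splits)
qed

lemma cmat_mult: "cmat (X ** Y) = cmat X ** cmat Y"
  by (simp add: vec_eq_iff matrix_matrix_mult_def)

lemma cmat_simps: "cmat (X + Y) = cmat X + cmat Y" "cmat (X - Y) = cmat X - cmat Y"
  "cmat (transpose Z) = transpose (cmat Z)" "cmat 0 = 0"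
  by (simp_all add: vec_eq_iff transpose_def)

lemma mat_spectrum_transpose: "mat_spectrum (transpose A) = mat_spectrum A"
proof -
  have "invertible (transpose X) \<longleftrightarrow> invertible X" for X :: "complex^'n^'n"
    unfolding invertible_def by (metis matrix_transpose_mul transpose_mat transpose_transpose)
  moreover have "transpose (mat s - A) = mat s - transpose A" for s
    by (simp add: vec_eq_iff transpose_def mat_def)
  ultimately show ?thesis
    using not_in_mat_spectrum_iff by (metis subsetI subset_antisym)
qed

lemma left_eigenvector_mat_spectrum:
  "z \<in> mat_spectrum A \<longleftrightarrow> (\<exists>x. x \<noteq> 0 \<and> x v* A = z *s x)"
  by (subst mat_spectrum_transpose[symmetric]) (simp add: mat_spectrum_def)

lemma lyapunov:
  assumes "riccati_solution A B C P"
  shows "closed_loop A C P ** P + P ** transpose (closed_loop A C P)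
     + filter_gain C P ** transpose (filter_gain C P) + B ** transpose B = 0" (is ?L)
   and "A ** P + P ** transpose (closed_loop A C P) + B ** transpose B = 0" (is ?K)
proof -
  have d: "(X - Y) ** Z = X ** Z - Y ** Z" for X Y :: "real^'n^'n" and Z :: "real^'n^'n"
    by (simp add: vec_eq_iff matrix_matrix_mult_def algebra_simps sum_subtractf)
  have d': "Z ** (X - Y) = Z ** X - Z ** Y" for X Y :: "real^'n^'n" and Z :: "real^'n^'n"
    by (simp add: vec_eq_iff matrix_matrix_mult_def algebra_simps sum_subtractf)
  have t: "transpose (X - Y) = transpose X - transpose Y" for X Y :: "real^'n^'n"
    by (simp add: vec_eq_iff transpose_def)
  have "transpose P = P" and
    r: "A ** P + P ** transpose A - P ** transpose C ** C ** P + B ** transpose B = 0"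
    using assms by (auto simp: riccati_solution_def)
  thus ?L ?K
    by (simp_all add: closed_loop_def filter_gain_def d d' t matrix_transpose_mul matrix_mul_assoc algebra_simps)
qed

text \<open>By stability of the closed loop, the factors \<open>M\<close> and \<open>N\<close> are well defined on the closed right half-plane,
  which contains all the points \<open>- \<lambda>\<^sub>i\<close>.\<close>

lemma closed_loop_stable:
  fixes A :: "real^'n^'n" and B :: "real^'m^'n" and C :: "real^'n^'p"
  assumes "stabilizable A B" "riccati_solution A B C P"
  shows "asymptotically_stable (closed_loop A C P)"
  unfolding asymptotically_stable_def
proof
  fix z assume "z \<in> mat_spectrum (cmat (closed_loop A C P))"
  then obtain x where x0: "x \<noteq> 0" and x: "x v* cmat (closed_loop A C P) = z *s x"
    unfolding left_eigenvector_mat_spectrum by auto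
  define u where "u = (\<chi> i. cnj (x $ i))"
  define dt where "dt = (\<lambda>(a :: complex^'n) (b::complex^'n). \<Sum>i\<in>UNIV. a $ i * b $ i)"
  define AF where "AF = cmat (closed_loop A C P)"
  define F where "F = cmat (filter_gain C P)"
  define Bc where "Bc = cmat B"
  define Pc where "Pc = cmat P"
  have "cmat (closed_loop A C P ** P + P ** transpose (closed_loop A C P)
     + filter_gain C P ** transpose (filter_gain C P) + B ** transpose B) = 0"
    by (subst lyapunov(1)[OF assms(2)]) (simp add: vec_eq_iff)
  hence "AF ** Pc + Pc ** transpose AF + F ** transpose F + Bc ** transpose Bc = 0"
    by (simp add: cmat_mult cmat_simps AF_def F_def Bc_def Pc_def)
  hence eq: "dt x ((AF ** Pc + Pc ** transpose AF + F ** transpose F + Bc ** transpose Bc) *v u) = 0"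
    by (simp add: dt_def)
  have dtadd: "dt a (b + c) = dt a b + dt a c" for a b c by (simp add: dt_def algebra_simps sum.distrib)
  have dtm: "dt a (X *v b) = (\<Sum>i\<in>UNIV. (a v* X) $ i * b $ i)" for a X and b :: "complex^'q"
    unfolding dt_def matrix_vector_mult_def vector_matrix_mult_def
    by (simp add: sum_distrib_left sum_distrib_right mult_ac) (subst sum.swap, simp)
  have xx: "x v* AF = z *s x" using x AF_def by simp
  have uu: "transpose AF *v u = cnj z *s u"
  proof -
    have "(transpose AF *v u) $ i = cnj ((x v* AF) $ i)" for i
      by (simp add: AF_def u_def vector_matrix_mult_def mult.commute)
    thus ?thesis by (simp add: xx vec_eq_iff u_def)
  qed
  have t1: "dt x ((AF ** Pc) *v u) = z * dt x (Pc *v u)"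
    using dtm[of x AF "Pc *v u"]
    by (simp add: matrix_vector_mul_assoc[symmetric] xx mult_ac)
       (simp add: dt_def sum_distrib_left mult_ac)
  have t2: "dt x ((Pc ** transpose AF) *v u) = cnj z * dt x (Pc *v u)"
    unfolding matrix_vector_mul_assoc[symmetric] uu
    by (simp add: vector_scalar_commute) (simp add: dt_def sum_distrib_left mult_ac)
  have nn: "dt x ((cmat X ** transpose (cmat X)) *v u) = of_real (\<Sum>i\<in>UNIV. (cmod ((x v* cmat X) $ i))\<^sup>2)"
    for X :: "real^'q^'n"
  proof -
    have "(transpose (cmat X) *v u) $ i = cnj ((x v* cmat X) $ i)" for i
      by (simp add: u_def vector_matrix_mult_def mult.commute)
    thus ?thesis
      unfolding matrix_vector_mul_assoc[symmetric]
      by (subst dtm) (simp add: complex_norm_square del: of_real_power)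
  qed
  have sym: "P $ i $ j = P $ j $ i" for i j
    using assms(2) unfolding riccati_solution_def transpose_def vec_eq_iff by auto
  define a where "a = (\<chi> i. Re (x $ i))"
  define b where "b = (\<chi> i. Im (x $ i))"
  have p: "Re (dt x (Pc *v u)) = a \<bullet> (P *v a) + b \<bullet> (P *v b)"
    by (simp add: dt_def Pc_def matrix_vector_mult_def inner_vec_def a_def b_def u_def
        sum_distrib_left algebra_simps sum.distrib)
  have p0: "Re (dt x (Pc *v u)) \<ge> 0"
    unfolding p using assms(2) by (simp add: riccati_solution_def)
  have "(z + cnj z) * dt x (Pc *v u)
     + of_real ((\<Sum>i\<in>UNIV. (cmod ((x v* F) $ i))\<^sup>2) + (\<Sum>i\<in>UNIV. (cmod ((x v* Bc) $ i))\<^sup>2)) = 0"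
    using eq t1 t2 nn[of "filter_gain C P"] nn[of B]
    by (simp add: matrix_vector_mult_add_rdistrib dtadd F_def Bc_def algebra_simps)
  hence "2 * Re z * Re (dt x (Pc *v u)) + ((\<Sum>i\<in>UNIV. (cmod ((x v* F) $ i))\<^sup>2) + (\<Sum>i\<in>UNIV. (cmod ((x v* Bc) $ i))\<^sup>2)) = 0"
    by (auto simp: complex_add_cnj complex_eq_iff)
  moreover have "(\<Sum>i\<in>UNIV. (cmod ((x v* F) $ i))\<^sup>2) \<ge> 0" "(\<Sum>i\<in>UNIV. (cmod ((x v* Bc) $ i))\<^sup>2) \<ge> 0"
    by (simp_all add: sum_nonneg)
  ultimately have s0: "(\<Sum>i\<in>UNIV. (cmod ((x v* F) $ i))\<^sup>2) = 0" "(\<Sum>i\<in>UNIV. (cmod ((x v* Bc) $ i))\<^sup>2) = 0" if "Re z \<ge> 0"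
    using mult_nonneg_nonneg[OF that p0] by (simp_all add: mult.assoc)
  show "Re z < 0"
  proof (rule ccontr)
    assume "\<not> Re z < 0"
    hence z: "Re z \<ge> 0" by simp
    have xF: "x v* F = 0" and xB: "x v* Bc = 0"
      using s0[OF z] by (simp_all add: sum_nonneg_eq_0_iff vec_eq_iff)
    obtain K where K: "asymptotically_stable (A - B ** K)"
      using assms(1) by (auto simp: stabilizable_def)
    have vsub: "x v* (X - Y) = x v* X - x v* Y" for X Y :: "complex^'n^'n"
      by (simp add: vec_eq_iff vector_matrix_mult_def algebra_simps sum_subtractf)
    have "x v* AF = x v* cmat A - (x v* F) v* cmat C"
      by (simp add: AF_def F_def closed_loop_def cmat_simps cmat_mult vsub vector_matrix_mul_assoc)
    hence "x v* cmat A = z *s x" using xF xx by simp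
    hence "x v* cmat (A - B ** K) = z *s x"
      using xB by (simp add: cmat_simps cmat_mult vsub vector_matrix_mul_assoc[symmetric] Bc_def)
    hence "z \<in> mat_spectrum (cmat (A - B ** K))"
      unfolding left_eigenvector_mat_spectrum using x0 by blast
    thus False using K z by (auto simp: asymptotically_stable_def)
  qed
qed

end

theory Submission
  imports Defs
begin

text \<open>
  Where both resolvents exist, \<open>N = M G\<close>, so \<open>G\<^sub>F\<close> maps \<open>(f, b)\<close> to \<open>M (f + G b)\<close>, and likewise
  for the reduced model. Applying the Riccati equation, in the form
  \<open>A P + P A\<^sub>F\<^sup>T + B B\<^sup>T = 0\<close>, to a left eigenvector \<open>w\<close> of \<open>A\<^sub>F\<close> with eigenvalue \<open>\<lambda>\<close> gives
  \<open>(-\<lambda> I - A) P w = B b\<close>, that is \<open>f = - C P w = - G(-\<lambda>) b\<close>. Hence both closed-loop transfer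
  functions annihilate \<open>(f, b)\<close> at \<open>-\<lambda>\<close> as soon as \<open>G\<close> and the reduced model agree there on \<open>b\<close>.
\<close>

lemma resolvent_inverse:
  assumes "s \<notin> mat_spectrum (cmat A)"
  shows "(mat s - cmat A) ** resolvent A s = mat 1"
    and "resolvent A s ** (mat s - cmat A) = mat 1"
proof -
  have inv: "invertible (mat s - cmat A)"
    using assms by (simp add: not_in_mat_spectrum_iff)
  show "(mat s - cmat A) ** resolvent A s = mat 1"
    "resolvent A s ** (mat s - cmat A) = mat 1"
    unfolding resolvent_def
    using someI_ex[OF inv[unfolded invertible_def]] matrix_inv_def[of "mat s - cmat A"] by auto
qed

lemma matrix_mult_diff:
  fixes X Y :: "'a::comm_ring_1^'n^'m"
  shows "(X - Y) ** Z = X ** Z - Y ** Z" and "U ** (X - Y) = U ** X - U ** Y"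
  by (simp_all add: vec_eq_iff matrix_matrix_mult_def algebra_simps sum_subtractf)

text \<open>Second resolvent identity for the perturbation of \<open>A\<close> by output injection:
  multiply \<open>s I - A = (s I - A_F) - F C\<close> by the closed-loop resolvent on the left and
  the open-loop one on the right.\<close>

lemma resolvent_closed_loop:
  assumes s: "s \<notin> mat_spectrum (cmat A)"
    and sF: "s \<notin> mat_spectrum (cmat (closed_loop A C P))"
  shows "resolvent (closed_loop A C P) s = resolvent A s -
    resolvent (closed_loop A C P) s ** cmat (filter_gain C P) ** cmat C ** resolvent A s"
proof -
  define RF where "RF = resolvent (closed_loop A C P) s"
  define FC where "FC = cmat (filter_gain C P) ** cmat C"
  have split: "mat s - cmat A = (mat s - cmat (closed_loop A C P)) - FC"
    by (simp add: closed_loop_def FC_def cmat_simps cmat_mult)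
  have "RF ** (mat s - cmat A) = mat 1 - RF ** FC"
    unfolding split
    by (simp only: matrix_mult_diff(2)[of RF "mat s - cmat (closed_loop A C P)"] resolvent_inverse(2)[OF sF, folded RF_def])
  hence "RF ** ((mat s - cmat A) ** resolvent A s) = resolvent A s - RF ** FC ** resolvent A s"
    by (simp add: matrix_mul_assoc matrix_mult_diff(1)[of "mat 1"])
  thus ?thesis
    by (simp add: resolvent_inverse(1)[OF s] RF_def FC_def matrix_mul_assoc)
qed

text \<open>The factorization \<open>G = M^-1 N\<close> without inverting \<open>M\<close>: it is
  the resolvent identity between \<open>C\<close> and \<open>B\<close>.\<close>

lemma factor_M_transfer:
  assumes "s \<notin> mat_spectrum (cmat A)" and "s \<notin> mat_spectrum (cmat (closed_loop A C P))"
  shows "factor_M A C P s ** transfer A B C s = factor_N A B C P s"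
  unfolding factor_N_def
  by (subst resolvent_closed_loop[OF assms])
     (simp add: factor_M_def transfer_def matrix_mult_diff matrix_mul_assoc)

lemma hcat_mult_vcat:
  fixes X :: "'a::semiring_1^'m^'p" and Y :: "'a^'k^'p"
  shows "hcat X Y *v vcat x y = X *v x + Y *v y"
  by (simp add: vec_eq_iff matrix_vector_mult_def hcat_def vcat_def
      sum.Plus flip: UNIV_Plus_UNIV)

lemma closed_loop_transfer_vcat:
  assumes "s \<notin> mat_spectrum (cmat A)" and "s \<notin> mat_spectrum (cmat (closed_loop A C P))"
  shows "closed_loop_transfer A B C P s *v vcat f b =
    factor_M A C P s *v (f + transfer A B C s *v b)"
  by (simp add: closed_loop_transfer_def hcat_mult_vcat factor_M_transfer[OF assms, symmetric]
      matrix_vector_right_distrib matrix_vector_mul_assoc)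

text \<open>Since \<open>f = - C P w\<close>, it suffices to solve
  \<open>(-lam I - A) x = B b\<close>, and the Riccati equation supplies the solution
  \<open>x = P w\<close>.\<close>

lemma transfer_residue_b:
  fixes A :: "real^'n^'n" and B :: "real^'m^'n" and C :: "real^'n^'p"
  assumes ric: "riccati_solution A B C P"
    and eig: "left_eigenbasis (closed_loop A C P) lam W"
    and s: "- lam i \<notin> mat_spectrum (cmat A)"
  shows "transfer A B C (- lam i) *v residue_b B W i = - residue_f C P W i"
proof -
  define w where "w = column i W"
  define S where "S = mat (- lam i) - cmat A"
  define AF where "AF = cmat (closed_loop A C P)"
  have w: "transpose AF *v w = lam i *s w"
    using eig by (simp add: left_eigenbasis_def AF_def w_def)
  \<comment> \<open>This mixed form has \<open>A\<close> on one side and the transposed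
    \<open>A_F\<close> on the other: the eigenvector absorbs the latter, and \<open>A\<close>, whose
    resolvent occurs in \<open>G\<close>, remains.\<close>
  have "cmat (A ** P + P ** transpose (closed_loop A C P) + B ** transpose B) *v w = 0"
    by (subst lyapunov(2)[OF ric]) (simp add: cmat_simps)
  hence "cmat A *v (cmat P *v w) + cmat P *v (transpose AF *v w)
      + cmat B *v (transpose (cmat B) *v w) = 0"
    by (simp only: cmat_simps cmat_mult AF_def matrix_vector_mult_add_rdistrib
        matrix_vector_mul_assoc)
  hence "cmat A *v (cmat P *v w) + lam i *s (cmat P *v w) + cmat B *v residue_b B W i = 0"
    by (simp only: w vector_scalar_commute residue_b_def flip: w_def)
  moreover have "mat c *v x = c *s x" for c and x :: "complex^'n"
    by (simp add: vec_eq_iff matrix_vector_mult_def mat_def if_distrib if_distribR cong: if_cong)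
  ultimately have "cmat B *v residue_b B W i = S *v (cmat P *v w)"
    by (simp add: S_def matrix_vector_mult_diff_rdistrib vector_smult_lneg eq_neg_iff_add_eq_0
        algebra_simps)
  hence "transfer A B C (- lam i) *v residue_b B W i
      = cmat C *v ((resolvent A (- lam i) ** S) *v (cmat P *v w))"
    by (simp add: transfer_def flip: matrix_vector_mul_assoc)
  also have "\<dots> = cmat C *v (cmat P *v w)"
    by (simp add: S_def resolvent_inverse(2)[OF s])
  also have "\<dots> = transpose (cmat (filter_gain C P)) *v w"
  \<comment> \<open>Symmetry of \<open>P\<close> turns the transpose of \<open>F = P C^T\<close>
    into \<open>C P\<close>.\<close>
  proof -
    have "transpose P = P"
      using ric by (simp add: riccati_solution_def)
    hence "transpose (filter_gain C P) = C ** P"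
      by (simp add: filter_gain_def matrix_transpose_mul)
    thus ?thesis
      by (simp only: flip: cmat_simps) (simp add: cmat_mult matrix_vector_mul_assoc)
  qed
  finally show ?thesis
    by (simp add: residue_f_def w_def)
qed

text \<open>Columns of an invertible matrix are nonzero, hence genuine eigenvectors. Together with
  closed-loop stability this places each \<open>-lam i\<close> in the open right half-plane.\<close>

lemma left_eigenbasis_mat_spectrum:
  assumes "left_eigenbasis A lam W"
  shows "lam i \<in> mat_spectrum (cmat A)"
proof -
  have "column i W \<noteq> 0"
  proof
    assume "column i W = 0"
    hence "det W = 0" by (rule det_zero_column)
    thus False using assms by (simp add: left_eigenbasis_def invertible_det_nz)
  qed
  thus ?thesis
    unfolding left_eigenvector_mat_spectrum using assms by (auto simp: left_eigenbasis_def)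
qed

lemma minus_mat_spectrum:
  assumes "z \<in> mat_spectrum A"
  shows "- z \<in> mat_spectrum (- A)"
proof -
  obtain v where "v \<noteq> 0" "A *v v = z *s v"
    using assms by (auto simp: mat_spectrum_def)
  moreover have "(- A) *v v = - (A *v v)"
    by (simp add: vec_eq_iff matrix_vector_mult_def sum_negf)
  ultimately show ?thesis
    by (auto simp: mat_spectrum_def vec_eq_iff)
qed

theorem corollary1:
  fixes A :: "real^'n^'n" and B :: "real^'m^'n" and C :: "real^'n^'p"
    and Ah :: "real^'r^'r" and Bh :: "real^'m^'r" and Ch :: "real^'r^'p"
    and P :: "real^'n^'n" and Ph :: "real^'r^'r"
    and lam :: "'n \<Rightarrow> complex" and W :: "complex^'n^'n"
    and lamh :: "'r \<Rightarrow> complex" and Wh :: "complex^'r^'r"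
  assumes "stabilizable A B" and "detectable A C"
    and "stabilizable Ah Bh" and "detectable Ah Ch"
    and "riccati_solution A B C P" and "riccati_solution Ah Bh Ch Ph"
    and "left_eigenbasis (closed_loop A C P) lam W"
    and "left_eigenbasis (closed_loop Ah Ch Ph) lamh Wh"
    and "mat_spectrum (cmat A) \<inter> mat_spectrum (- cmat (closed_loop A C P)) = {}"
  shows
    "(\<forall>i. - lam i \<notin> mat_spectrum (cmat Ah) \<and>
          transfer Ah Bh Ch (- lam i) *v residue_b B W i =
          transfer A B C (- lam i) *v residue_b B W i \<longrightarrow>
        closed_loop_transfer Ah Bh Ch Ph (- lam i) *v
            vcat (residue_f C P W i) (residue_b B W i) =
          closed_loop_transfer A B C P (- lam i) *v
            vcat (residue_f C P W i) (residue_b B W i) \<and>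
        closed_loop_transfer A B C P (- lam i) *v
            vcat (residue_f C P W i) (residue_b B W i) = 0) \<and>
     (\<forall>j. - lamh j \<notin> mat_spectrum (cmat Ah) \<and>
          - lamh j \<notin> mat_spectrum (cmat A) \<and>
          transfer Ah Bh Ch (- lamh j) *v residue_b Bh Wh j =
          transfer A B C (- lamh j) *v residue_b Bh Wh j \<longrightarrow>
        closed_loop_transfer Ah Bh Ch Ph (- lamh j) *v
            vcat (residue_f Ch Ph Wh j) (residue_b Bh Wh j) =
          closed_loop_transfer A B C P (- lamh j) *v
            vcat (residue_f Ch Ph Wh j) (residue_b Bh Wh j) \<and>
        closed_loop_transfer A B C P (- lamh j) *v
            vcat (residue_f Ch Ph Wh j) (residue_b Bh Wh j) = 0)"
proof -
  have stable: "z \<in> mat_spectrum (cmat (closed_loop A C P)) \<Longrightarrow> Re z < 0"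
    and stableh: "z \<in> mat_spectrum (cmat (closed_loop Ah Ch Ph)) \<Longrightarrow> Re z < 0" for z
    using closed_loop_stable[OF assms(1,5)] closed_loop_stable[OF assms(3,6)]
    by (auto simp: asymptotically_stable_def)
  note lam = left_eigenbasis_mat_spectrum[OF assms(7)]
    and lamh = left_eigenbasis_mat_spectrum[OF assms(8)]
  \<comment> \<open>Stability keeps \<open>z\<close> off the closed-loop spectrum, so the value is
    \<open>M(z) (- G(z) b + G(z) b)\<close>. The vector \<open>b\<close> is arbitrary, so that
    residues of either model can be inserted.\<close>
  have ann: "closed_loop_transfer A B C P z *v vcat (- (transfer A B C z *v b)) b = 0"
    if "z \<notin> mat_spectrum (cmat A)" "Re z > 0" for z b
    using that stable[of z] by (subst closed_loop_transfer_vcat) auto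
  have annh: "closed_loop_transfer Ah Bh Ch Ph z *v vcat (- (transfer Ah Bh Ch z *v b)) b = 0"
    if "z \<notin> mat_spectrum (cmat Ah)" "Re z > 0" for z b
    using that stableh[of z] by (subst closed_loop_transfer_vcat) auto
  show ?thesis
  proof (intro conjI allI impI; (elim conjE)?)
    fix i
    assume h: "- lam i \<notin> mat_spectrum (cmat Ah)"
      and eq: "transfer Ah Bh Ch (- lam i) *v residue_b B W i =
        transfer A B C (- lam i) *v residue_b B W i"
    \<comment> \<open>The point \<open>-lam i\<close> is an eigenvalue of \<open>- A_F\<close>, so
      disjointness of the spectra excludes it from that of \<open>A\<close>.\<close>
    have s: "- lam i \<notin> mat_spectrum (cmat A)"
      using minus_mat_spectrum[OF lam[of i]] assms(9) by auto
    have f: "residue_f C P W i = - (transfer A B C (- lam i) *v residue_b B W i)"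
      using transfer_residue_b[OF assms(5,7) s] by simp
    have re: "Re (- lam i) > 0"
      using stable[OF lam[of i]] by simp
    show 0: "closed_loop_transfer A B C P (- lam i) *v
        vcat (residue_f C P W i) (residue_b B W i) = 0"
      unfolding f by (rule ann[OF s re])
    show "closed_loop_transfer Ah Bh Ch Ph (- lam i) *v
          vcat (residue_f C P W i) (residue_b B W i) =
        closed_loop_transfer A B C P (- lam i) *v
          vcat (residue_f C P W i) (residue_b B W i)"
      \<comment> \<open>Interpolation enters only here: it rewrites \<open>f\<close> through the
        reduced transfer function, so that the reduced annihilation applies.\<close>
      unfolding 0 unfolding f eq[symmetric] by (rule annh[OF h re])
  next
    fix j
    assume h: "- lamh j \<notin> mat_spectrum (cmat Ah)" and s: "- lamh j \<notin> mat_spectrum (cmat A)"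
      and eq: "transfer Ah Bh Ch (- lamh j) *v residue_b Bh Wh j =
        transfer A B C (- lamh j) *v residue_b Bh Wh j"
    \<comment> \<open>The roles are exchanged: the reduced Riccati equation determines
      \<open>f\<close>, and interpolation carries it over to the full model.\<close>
    have f: "residue_f Ch Ph Wh j = - (transfer Ah Bh Ch (- lamh j) *v residue_b Bh Wh j)"
      using transfer_residue_b[OF assms(6,8) h] by simp
    have re: "Re (- lamh j) > 0"
      using stableh[OF lamh[of j]] by simp
    show 0: "closed_loop_transfer A B C P (- lamh j) *v
        vcat (residue_f Ch Ph Wh j) (residue_b Bh Wh j) = 0"
      unfolding f eq by (rule ann[OF s re])
    show "closed_loop_transfer Ah Bh Ch Ph (- lamh j) *v
          vcat (residue_f Ch Ph Wh j) (residue_b Bh Wh j) =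
        closed_loop_transfer A B C P (- lamh j) *v
          vcat (residue_f Ch Ph Wh j) (residue_b Bh Wh j)"
      unfolding 0 unfolding f by (rule annh[OF h re])
  qed
qed

end
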